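(* Let $C>0$. If $(X_1,d)$ and $(X_2,d)$ are both $C$-rCAT($0;*$) spaces, then their $l^2$-product $(X,d)$ is a $(\sqrt2\,C)$-rCAT($0;*$) space.
   Context: The $l^2$-product of metric spaces $(X_1,d)$, $(X_2,d)$ is $X=X_1\times X_2$ with the metric $d((x_1,x_2),(y_1,y_2))=\sqrt{d(x_1,y_1)^2+d(x_2,y_2)^2}$ (the letter $d$ denotes the metric in each of the three spaces). A length space is a metric space $(X,d)$ in which $d(x,y)$ is the infimum of the lengths of paths joining $x$ and $y$, for all $x,y$. For $h\ge 0$, an $h$-short segment $[x,y]_h$ from $x$ to $y$ is a path $\gamma:[0,L]\to X$ from $x$ to $y$ with $\mathrm{len}(\gamma)\le d(x,y)+h$. For a point $u=\gamma(t)$ on it, $[x,u]_h$ and $[u,y]_h$ denote the subpaths $\gamma|_{[0,t]}$ and $\gamma|_{[t,L]}$. An $h$-short triangle $T_h(x,y,z)$ consists of $x,y,z\in X$ with a choice of $h$-short segments (sides) $[x,y]_h,[y,z]_h,[z,x]_h$. A comparison triangle is a Euclidean triangle $T(\bar x,\bar y,\bar z)$ in the plane with $|\bar x-\bar y|=d(x,y)$, $|\bar y-\bar z|=d(y,z)$, $|\bar z-\bar x|=d(z,x)$. A comparison point for $u\in[x,y]_h$ is any $\bar u\in[\bar x,\bar y]$ with $|\bar x-\bar u|\le\mathrm{len}([x,u]_h)$ and $|\bar u-\bar y|\le\mathrm{len}([u,y]_h)$ (not necessarily unique); similarly for the other sides. A length space $X$ is $C$-rCAT($0;*$) if there is a function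 $H:X\times X\times X\to(0,\infty)$ such that for all $x,y,z\in X$ and every $h$-short triangle $T_h(x,y,z)$ with $h=H(x,y,z)$, one has $d(u,v)\le|\bar u-\bar v|+C$ whenever $u,v$ lie on different sides of $T_h(x,y,z)$ and $\bar u,\bar v$ are corresponding comparison points on a comparison triangle. *)

theory Defs
  imports "HOL-Analysis.Analysis"
begin

(* Supremum over the partitions a = s 0 <= s 1 <= ... <= s n = b; a path may have infinite
   length, hence the type ereal.  Only meaningful for a <= b. *)
definition path_len :: "'a metric \<Rightarrow> (real \<Rightarrow> 'a) \<Rightarrow> real \<Rightarrow> real \<Rightarrow> ereal" where
  "path_len m \<gamma> a b =
     (SUP (n, s) \<in> {(n :: nat, s :: nat \<Rightarrow> real).
                      s 0 = a \<and> s n = b \<and> (\<forall>i<n. s i \<le> s (Suc i))}.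
        ereal (\<Sum>i<n. mdist m (\<gamma> (s i)) (\<gamma> (s (Suc i)))))"

(* A path defined on the interval [0,L]; the values of \<gamma> outside [0,L] are irrelevant. *)
definition path_between :: "'a metric \<Rightarrow> 'a \<Rightarrow> 'a \<Rightarrow> real \<Rightarrow> (real \<Rightarrow> 'a) \<Rightarrow> bool" where
  "path_between m x y L \<gamma> \<longleftrightarrow>
     0 \<le> L \<and> continuous_map (top_of_set {0..L}) (mtopology_of m) \<gamma> \<and> \<gamma> 0 = x \<and> \<gamma> L = y"

(* If no path joins x and y, the infimum is infinity and the equation fails. *)
definition length_space :: "'a metric \<Rightarrow> bool" where
  "length_space m \<longleftrightarrow>
     (\<forall>x \<in> mspace m. \<forall>y \<in> mspace m.
        ereal (mdist m x y) = (INF (L, \<gamma>) \<in> {(L, \<gamma>). path_between m x y L \<gamma>}. path_len m \<gamma> 0 L))"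

definition short_segment ::
  "'a metric \<Rightarrow> real \<Rightarrow> 'a \<Rightarrow> 'a \<Rightarrow> real \<Rightarrow> (real \<Rightarrow> 'a) \<Rightarrow> bool" where
  "short_segment m h x y L \<gamma> \<longleftrightarrow>
     path_between m x y L \<gamma> \<and> path_len m \<gamma> 0 L \<le> ereal (mdist m x y + h)"

definition comparison_triangle ::
  "'a metric \<Rightarrow> 'a \<Rightarrow> 'a \<Rightarrow> 'a \<Rightarrow> real^2 \<Rightarrow> real^2 \<Rightarrow> real^2 \<Rightarrow> bool" where
  "comparison_triangle m x y z x' y' z' \<longleftrightarrow>
     dist x' y' = mdist m x y \<and> dist y' z' = mdist m y z \<and> dist z' x' = mdist m z x"

(* u' is a comparison point, on the Euclidean side [x',y'], for the point \<gamma> t of the side \<gamma>.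
   The point of the side is given by its parameter t, since a path may pass several times
   through the same point and the subpaths on [0,t] and [t,L] depend on t. *)
definition comparison_point ::
  "'a metric \<Rightarrow> real \<Rightarrow> (real \<Rightarrow> 'a) \<Rightarrow> real^2 \<Rightarrow> real^2 \<Rightarrow> real \<Rightarrow> real^2 \<Rightarrow> bool" where
  "comparison_point m L \<gamma> x' y' t u' \<longleftrightarrow>
     u' \<in> closed_segment x' y' \<and>
     ereal (dist x' u') \<le> path_len m \<gamma> 0 t \<and> ereal (dist u' y') \<le> path_len m \<gamma> t L"

(* The inequality d(u,v) <= |u' - v'| + C for all points u, v on the sides \<alpha>, \<beta> and all their
   comparison points u', v' on the Euclidean sides [a',b'], [c',e']. *)
definition sides_compare ::
  "'a metric \<Rightarrow> real \<Rightarrow> real \<Rightarrow> (real \<Rightarrow> 'a) \<Rightarrow> real^2 \<Rightarrow> real^2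
     \<Rightarrow> real \<Rightarrow> (real \<Rightarrow> 'a) \<Rightarrow> real^2 \<Rightarrow> real^2 \<Rightarrow> bool" where
  "sides_compare m C K \<alpha> a' b' L \<beta> c' e' \<longleftrightarrow>
     (\<forall>s \<in> {0..K}. \<forall>t \<in> {0..L}. \<forall>u' v'.
        comparison_point m K \<alpha> a' b' s u' \<longrightarrow> comparison_point m L \<beta> c' e' t v' \<longrightarrow>
        mdist m (\<alpha> s) (\<beta> t) \<le> dist u' v' + C)"

(* The three unordered pairs of different sides suffice, as the compared quantities are
   symmetric in u, v. *)
definition rCAT0_star :: "real \<Rightarrow> 'a metric \<Rightarrow> bool" where
  "rCAT0_star C m \<longleftrightarrow>
     length_space m \<and>
     (\<exists>H :: 'a \<Rightarrow> 'a \<Rightarrow> 'a \<Rightarrow> real.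
        \<forall>x \<in> mspace m. \<forall>y \<in> mspace m. \<forall>z \<in> mspace m.
          0 < H x y z \<and>
          (\<forall>L1 \<gamma>1 L2 \<gamma>2 L3 \<gamma>3 x' y' z'.
             short_segment m (H x y z) x y L1 \<gamma>1 \<longrightarrow>
             short_segment m (H x y z) y z L2 \<gamma>2 \<longrightarrow>
             short_segment m (H x y z) z x L3 \<gamma>3 \<longrightarrow>
             comparison_triangle m x y z x' y' z' \<longrightarrow>
             sides_compare m C L1 \<gamma>1 x' y' L2 \<gamma>2 y' z' \<and>
             sides_compare m C L2 \<gamma>2 y' z' L3 \<gamma>3 z' x' \<and>
             sides_compare m C L3 \<gamma>3 z' x' L1 \<gamma>1 x' y'))"

end

theory Submission
  imports Defs
begin

text \<open>If \<open>u'\<close> divides the Euclidean side \<open>[x',y']\<close> in the ratio \<open>a : 1 - a\<close> and is a comparison point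
  for \<open>u = (u1,u2)\<close> on an \<open>h\<close>-short segment of the product, then each \<open>ui\<close> nearly divides \<open>[xi,yi]\<close>
  in the same ratio, up to an error that tends to \<open>0\<close> with \<open>h\<close>.  In the factor, \<open>ui\<close> is put on a new
  short segment, for which the point exactly in the ratio \<open>a : 1 - a\<close> is a comparison point; the
  triangle condition of the factor applies to this segment.  For two such points on two sides, the
  squared distance in the comparison triangle is a fixed linear function of the squared side
  lengths, so the squared Euclidean distances of the factors add up to that of the product, and
  Minkowski's inequality turns the two errors \<open>C\<close> into \<open>\<bar>(C,C)\<bar> = sqrt 2 * C\<close>.\<close>

section \<open>Lengths of paths\<close>

lemma mdist_self: "x \<in> mspace m \<Longrightarrow> mdist m x x = 0"
  by simp

lemma path_len_upper:
  assumes "s 0 = a" "s n = b" "\<forall>i<n. s i \<le> s (Suc i)"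
  shows "ereal (\<Sum>i<n. mdist m (\<gamma> (s i)) (\<gamma> (s (Suc i)))) \<le> path_len m \<gamma> a b"
  unfolding path_len_def using assms by (intro SUP_upper2[where i = "(n, s)"]) auto

lemma path_len_least:
  assumes "\<And>n s. s 0 = a \<Longrightarrow> s n = b \<Longrightarrow> (\<forall>i<n. s i \<le> s (Suc i)) \<Longrightarrow>
    ereal (\<Sum>i<n. mdist m (\<gamma> (s i)) (\<gamma> (s (Suc i)))) \<le> l"
  shows "path_len m \<gamma> a b \<le> l"
  unfolding path_len_def using assms by (intro SUP_least) auto

lemma partition_mem:
  fixes s :: "nat \<Rightarrow> real"
  assumes "\<forall>i<n. s i \<le> s (Suc i)" "i \<le> n"
  shows "s i \<in> {s 0..s n}"
proof -
  have "s j \<le> s k" if "j \<le> k" "k \<le> n" for j k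
    using that
  proof (induction k rule: dec_induct)
    case (step k)
    then show ?case using assms(1) by (meson Suc_le_lessD less_imp_le_nat order_trans)
  qed simp
  then show ?thesis using assms(2) by auto
qed

lemma mdist_le_path_len:
  assumes "a \<le> b"
  shows "ereal (mdist m (\<gamma> a) (\<gamma> b)) \<le> path_len m \<gamma> a b"
  using path_len_upper[of "\<lambda>i. if i = 0 then a else b" a 1 b m \<gamma>] assms by auto

lemma path_len_nonneg:
  assumes "a \<le> b"
  shows "0 \<le> path_len m \<gamma> a b"
  using mdist_le_path_len[OF assms, of m \<gamma>] by (metis ereal_less_eq(5) mdist_nonneg order_trans)

text \<open>A partition of \<open>[a,b]\<close>, translated by \<open>r\<close>, gives the same sum
  for \<open>\<gamma>'\<close>. This carries lower bounds on lengths over to the two pieces of a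
  concatenation.\<close>

lemma path_len_shift_le:
  assumes "\<And>t. t \<in> {a..b} \<Longrightarrow> \<gamma>' (t + r) = \<gamma> t"
  shows "path_len m \<gamma> a b \<le> path_len m \<gamma>' (a + r) (b + r)"
proof (rule path_len_least)
  fix n and s :: "nat \<Rightarrow> real"
  assume s: "s 0 = a" "s n = b" "\<forall>i<n. s i \<le> s (Suc i)"
  have "\<gamma>' (s i + r) = \<gamma> (s i)" if "i \<le> n" for i
    using assms partition_mem[OF s(3) that] s by simp
  then have "(\<Sum>i<n. mdist m (\<gamma> (s i)) (\<gamma> (s (Suc i)))) =
      (\<Sum>i<n. mdist m (\<gamma>' (s i + r)) (\<gamma>' (s (Suc i) + r)))"
    by (intro sum.cong) auto
  also have "ereal \<dots> \<le> path_len m \<gamma>' (a + r) (b + r)"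
    using s by (intro path_len_upper) auto
  finally show "ereal (\<Sum>i<n. mdist m (\<gamma> (s i)) (\<gamma> (s (Suc i)))) \<le> path_len m \<gamma>' (a + r) (b + r)" .
qed

text \<open>A partition of \<open>[a,b]\<close> followed by one of \<open>[b,c]\<close> is a
  partition of \<open>[a,c]\<close>. The two suprema are taken one after the other, each time with
  the other summand finite and moved to the right-hand side.\<close>

lemma path_len_superadditive:
  assumes "a \<le> b" "b \<le> c"
  shows "path_len m \<gamma> a b + path_len m \<gamma> b c \<le> path_len m \<gamma> a c"
proof -
  let ?S = "\<lambda>n s. \<Sum>i<n. mdist m (\<gamma> (s i)) (\<gamma> (s (Suc i)))"
  have concat: "ereal (?S n s) + ereal (?S k r) \<le> path_len m \<gamma> a c"
    if s: "s 0 = a" "s n = b" "\<forall>i<n. s i \<le> s (Suc i)"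
    and r: "r 0 = b" "r k = c" "\<forall>i<k. r i \<le> r (Suc i)"
    for n k and s r :: "nat \<Rightarrow> real"
  proof -
    define q where "q i = (if i \<le> n then s i else r (i - n))" for i
    \<comment> \<open>At \<open>i = 0\<close> this is the junction
      \<open>s n = b = r 0\<close>.\<close>
    have q2: "q (n + i) = r i" for i using s r by (auto simp: q_def)
    have q1: "q i = s i" if "i \<le> n" for i using that by (auto simp: q_def)
    have "?S (n + k) q = ?S n q + (\<Sum>i<k. mdist m (\<gamma> (q (n + i))) (\<gamma> (q (n + Suc i))))"
      by (induction k) auto
    also have "?S n q = ?S n s" by (intro sum.cong) (auto simp: q1)
    finally have "?S (n + k) q = ?S n s + ?S k r" by (simp only: q2)
    moreover have "ereal (?S (n + k) q) \<le> path_len m \<gamma> a c"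
    proof (rule path_len_upper)
      show "\<forall>i<n + k. q i \<le> q (Suc i)"
      proof (intro allI impI)
        fix i assume i: "i < n + k"
        show "q i \<le> q (Suc i)"
        proof (cases "i < n")
          case True then show ?thesis using s by (simp add: q1)
        next
          case False
          then obtain j where "i = n + j" by (metis leI le_Suc_ex)
          then show ?thesis using r i q2[of j] q2[of "Suc j"] by simp
        qed
      qed
    qed (use s r q2[of k] q1[of 0] in auto)
    ultimately show ?thesis by simp
  qed
  have left: "path_len m \<gamma> a b + ereal (?S k r) \<le> path_len m \<gamma> a c"
    if r: "r 0 = b" "r k = c" "\<forall>i<k. r i \<le> r (Suc i)" for k and r :: "nat \<Rightarrow> real"
  proof -
    have "path_len m \<gamma> a b \<le> path_len m \<gamma> a c - ereal (?S k r)"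
      using concat[OF _ _ _ r] by (intro path_len_least) (auto simp: ereal_le_minus)
    then show ?thesis by (simp add: ereal_le_minus)
  qed
  show ?thesis
  proof (cases "path_len m \<gamma> a b = \<infinity>")
    case True
    \<comment> \<open>The one-step partition \<open>b, c\<close> is enough to force
      \<open>path_len m \<gamma> a c\<close> to be infinite as well.\<close>
    have "path_len m \<gamma> a b + ereal (?S 1 (\<lambda>i. if i = 0 then b else c)) \<le> path_len m \<gamma> a c"
      using assms by (intro left) auto
    then show ?thesis using True by simp
  next
    case False
    then have fin: "\<bar>path_len m \<gamma> a b\<bar> \<noteq> \<infinity>" using path_len_nonneg[OF assms(1), of m \<gamma>] by auto
    then have "path_len m \<gamma> b c \<le> path_len m \<gamma> a c - path_len m \<gamma> a b"
      using left by (intro path_len_least) (auto simp: ereal_le_minus add.commute)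
    then show ?thesis using fin by (simp add: ereal_le_minus add.commute)
  qed
qed

section \<open>One-Lipschitz paths\<close>

text \<open>A path on \<open>[0,c]\<close> with this property is continuous and has length at most
  \<open>c\<close>. The encoding replaces a bound on a supremum by a pointwise inequality that is
  easy to rescale and to concatenate.\<close>

definition lip_path :: "'a metric \<Rightarrow> 'a \<Rightarrow> 'a \<Rightarrow> real \<Rightarrow> (real \<Rightarrow> 'a) \<Rightarrow> bool" where
  "lip_path m x y c g \<longleftrightarrow> 0 \<le> c \<and> g \<in> {0..c} \<rightarrow> mspace m \<and> g 0 = x \<and> g c = y \<and>
     (\<forall>s\<in>{0..c}. \<forall>t\<in>{0..c}. mdist m (g s) (g t) \<le> \<bar>s - t\<bar>)"

lemma lip_path_path_len:
  assumes "lip_path m x y c g"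
  shows "path_len m g 0 c \<le> ereal c"
proof (rule path_len_least)
  fix n and s :: "nat \<Rightarrow> real"
  assume s: "s 0 = 0" "s n = c" "\<forall>i<n. s i \<le> s (Suc i)"
  have "(\<Sum>i<n. mdist m (g (s i)) (g (s (Suc i)))) \<le> (\<Sum>i<n. s (Suc i) - s i)"
  proof (rule sum_mono)
    fix i assume i: "i \<in> {..<n}"
    then have "s i \<in> {0..c}" "s (Suc i) \<in> {0..c}" "s i \<le> s (Suc i)"
      using partition_mem[OF s(3), of i] partition_mem[OF s(3), of "Suc i"] s by auto
    then show "mdist m (g (s i)) (g (s (Suc i))) \<le> s (Suc i) - s i"
      using assms unfolding lip_path_def by (smt (verit))
  qed
  also have "\<dots> = c" using s by (simp add: sum_lessThan_telescope)
  finally show "ereal (\<Sum>i<n. mdist m (g (s i)) (g (s (Suc i)))) \<le> ereal c" by simp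
qed

lemma lip_path_path_between:
  assumes "lip_path m x y c g"
  shows "path_between m x y c g"
proof -
  have "Lipschitz_continuous_map (submetric euclidean_metric {0..c}) m g"
    using assms unfolding lip_path_def Lipschitz_continuous_map_def
    by (auto simp: dist_real_def intro!: exI[of _ 1])
  then have "continuous_map (top_of_set {0..c}) (mtopology_of m) g"
    using Lipschitz_continuous_imp_continuous_map by (metis mtopology_of_euclidean mtopology_of_submetric)
  then show ?thesis using assms by (auto simp: path_between_def lip_path_def)
qed

text \<open>For times on different sides of \<open>c1\<close> the triangle inequality through
  \<open>y\<close> applies, and the two Lipschitz bounds add up exactly because \<open>c1\<close>
  lies between the times.\<close>

lemma lip_path_join:
  assumes "lip_path m x y c1 g1" "lip_path m y z c2 g2"
  shows "lip_path m x z (c1 + c2) (\<lambda>t. if t \<le> c1 then g1 t else g2 (t - c1))"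
proof -
  let ?g = "\<lambda>t. if t \<le> c1 then g1 t else g2 (t - c1)"
  have A: "0 \<le> c1" "0 \<le> c2" "g1 0 = x" "g1 c1 = y" "g2 0 = y" "g2 c2 = z"
      "g1 \<in> {0..c1} \<rightarrow> mspace m" "g2 \<in> {0..c2} \<rightarrow> mspace m"
    using assms unfolding lip_path_def by auto
  have lip1: "mdist m (g1 s) (g1 t) \<le> \<bar>s - t\<bar>" if "s \<in> {0..c1}" "t \<in> {0..c1}" for s t
    using assms(1) that unfolding lip_path_def by blast
  have lip2: "mdist m (g2 s) (g2 t) \<le> \<bar>s - t\<bar>" if "s \<in> {0..c2}" "t \<in> {0..c2}" for s t
    using assms(2) that unfolding lip_path_def by blast
  have cross: "mdist m (?g s) (?g t) \<le> t - s" if "0 \<le> s" "s \<le> t" "t \<le> c1 + c2" for s t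
  proof -
    consider "t \<le> c1" | "c1 < s" | "s \<le> c1" "c1 < t" by linarith
    then show ?thesis
    proof cases
      case 1
      then show ?thesis using lip1[of s t] that by simp
    next
      case 2
      then show ?thesis using lip2[of "s - c1" "t - c1"] that by simp
    next
      case 3
      then have mem: "s \<in> {0..c1}" "c1 \<in> {0..c1}" "t - c1 \<in> {0..c2}" "0 \<in> {0..c2}"
        using that A by auto
      have "g1 s \<in> mspace m" "g1 c1 \<in> mspace m" "g2 (t - c1) \<in> mspace m"
        using A mem by (blast dest: Pi_mem)+
      then have "mdist m (g1 s) (g2 (t - c1)) \<le> mdist m (g1 s) (g1 c1) + mdist m (g1 c1) (g2 (t - c1))"
        by (rule mdist_triangle)
      also have "\<dots> = mdist m (g1 s) (g1 c1) + mdist m (g2 0) (g2 (t - c1))" using A by simp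
      also have "\<dots> \<le> \<bar>s - c1\<bar> + \<bar>0 - (t - c1)\<bar>"
        using mem by (intro add_mono lip1 lip2)
      finally show ?thesis using 3 that by auto
    qed
  qed
  have "mdist m (?g s) (?g t) \<le> \<bar>s - t\<bar>" if "s \<in> {0..c1 + c2}" "t \<in> {0..c1 + c2}" for s t
  proof (cases "s \<le> t")
    case True
    then show ?thesis using cross[of s t] that by auto
  next
    case False
    then show ?thesis using cross[of t s] that mdist_commute[of m "?g s" "?g t"] by auto
  qed
  moreover have "?g 0 = x" "?g (c1 + c2) = z" "0 \<le> c1 + c2"
    using A by (auto simp: order_antisym_conv)
  moreover have "?g \<in> {0..c1 + c2} \<rightarrow> mspace m"
    using A by (auto simp: Pi_iff)
  ultimately show ?thesis unfolding lip_path_def by blast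
qed

section \<open>Reparametrization of a path by its length\<close>

lemma path_between_near:
  assumes "path_between m x y L \<gamma>" "t0 \<in> {0..L}" "e > 0"
  obtains d where "d > 0" "\<And>t. t \<in> {0..L} \<Longrightarrow> \<bar>t - t0\<bar> < d \<Longrightarrow> mdist m (\<gamma> t0) (\<gamma> t) < e"
proof -
  have c: "continuous_map (top_of_set {0..L}) (mtopology_of m) \<gamma>"
    using assms by (simp add: path_between_def)
  have "\<exists>U. openin (top_of_set {0..L}) U \<and> t0 \<in> U \<and>
      (\<forall>y\<in>U. \<gamma> y \<in> Metric_space.mball (mspace m) (mdist m) (\<gamma> t0) e)"
    using c assms(2,3) unfolding mtopology_of_def
    by (subst (asm) Metric_space.continuous_map_to_metric) auto
  then obtain U where U: "openin (top_of_set {0..L}) U" "t0 \<in> U"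
      "\<And>t. t \<in> U \<Longrightarrow> mdist m (\<gamma> t0) (\<gamma> t) < e"
    by (auto simp: Metric_space.in_mball)
  then obtain d where "d > 0" "\<And>t. t \<in> {0..L} \<Longrightarrow> dist t t0 < d \<Longrightarrow> t \<in> U"
    unfolding openin_euclidean_subtopology_iff by blast
  then show ?thesis using U(3) that by (auto simp: dist_real_def)
qed

lemma path_between_mem:
  assumes "path_between m x y L \<gamma>" "t \<in> {0..L}"
  shows "\<gamma> t \<in> mspace m"
  using assms continuous_map_image_subset_topspace[of "top_of_set {0..L}" "mtopology_of m" \<gamma>]
  by (auto simp: path_between_def)

text \<open>The reparametrization is \<open>s \<mapsto> \<gamma> (\<tau> s)\<close>, where \<open>\<tau> s\<close> is the last time at which the length
  travelled is at most \<open>s\<close>.  Between \<open>\<tau> s\<close> and \<open>\<tau> s'\<close> this length stays within \<open>[s,s']\<close>,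
  so continuity of \<open>\<gamma>\<close> alone gives the Lipschitz bound, even where the length function itself
  is not known to be continuous.\<close>

lemma reparametrize:
  assumes p: "path_between m x y L \<gamma>" and l: "path_len m \<gamma> 0 L \<le> ereal l"
  shows "\<exists>g. lip_path m x y l g"
proof -
  have L: "0 \<le> L" and ends: "\<gamma> 0 = x" "\<gamma> L = y" using p by (auto simp: path_between_def)
  \<comment> \<open>The length travelled up to time \<open>t\<close>. By superadditivity it is
    bounded by the total length, so it is finite and can be handled as a real number.\<close>
  define f where "f t = real_of_ereal (path_len m \<gamma> 0 t)" for t
  have fin: "path_len m \<gamma> 0 t = ereal (f t)" "f t \<le> l" "0 \<le> f t" if "t \<in> {0..L}" for t
  proof -
    have "path_len m \<gamma> 0 t + 0 \<le> path_len m \<gamma> 0 t + path_len m \<gamma> t L"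
      using that path_len_nonneg by (intro add_left_mono) auto
    also have "\<dots> \<le> path_len m \<gamma> 0 L" using that by (intro path_len_superadditive) auto
    also have "\<dots> \<le> ereal l" by fact
    finally have "path_len m \<gamma> 0 t \<le> ereal l" by simp
    moreover have "0 \<le> path_len m \<gamma> 0 t" using that by (intro path_len_nonneg) auto
    ultimately have "path_len m \<gamma> 0 t = ereal (f t) \<and> f t \<le> l \<and> 0 \<le> f t"
      unfolding f_def by (cases "path_len m \<gamma> 0 t") auto
    then show "path_len m \<gamma> 0 t = ereal (f t)" "f t \<le> l" "0 \<le> f t" by auto
  qed
  have step: "mdist m (\<gamma> t) (\<gamma> t') \<le> f t' - f t" if "0 \<le> t" "t \<le> t'" "t' \<le> L" for t t'
  proof -
    have "path_len m \<gamma> 0 t + ereal (mdist m (\<gamma> t) (\<gamma> t')) \<le> path_len m \<gamma> 0 t + path_len m \<gamma> t t'"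
      using that mdist_le_path_len by (intro add_left_mono) auto
    also have "\<dots> \<le> path_len m \<gamma> 0 t'" using that by (intro path_len_superadditive) auto
    finally show ?thesis using that fin by simp
  qed
  have mono: "f t \<le> f t'" if "0 \<le> t" "t \<le> t'" "t' \<le> L" for t t'
    using step[OF that] mdist_nonneg[of m "\<gamma> t" "\<gamma> t'"] by linarith
  have f0: "f 0 = 0"
  proof -
    have "path_len m \<gamma> 0 0 \<le> ereal 0"
    proof (rule path_len_least)
      fix n and s :: "nat \<Rightarrow> real"
      assume s: "s 0 = 0" "s n = 0" "\<forall>i<n. s i \<le> s (Suc i)"
      have "s i = 0" if "i \<le> n" for i using partition_mem[OF s(3) that] s by auto
      then have "(\<Sum>i<n. mdist m (\<gamma> (s i)) (\<gamma> (s (Suc i)))) = (\<Sum>i<n. 0)"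
        using path_between_mem[OF p, of 0] L by (intro sum.cong) auto
      then show "ereal (\<Sum>i<n. mdist m (\<gamma> (s i)) (\<gamma> (s (Suc i)))) \<le> ereal 0" by simp
    qed
    then show ?thesis using fin[of 0] L by simp
  qed
  have l0: "0 \<le> l" using fin[of 0] L by simp
  define A where "A s = {t \<in> {0..L}. f t \<le> s}" for s
  define \<tau> where "\<tau> s = Sup (A s)" for s
  have A0: "0 \<in> A s" if "0 \<le> s" for s using that f0 L by (auto simp: A_def)
  have bdd: "bdd_above (A s)" for s by (rule bdd_aboveI[of _ L]) (auto simp: A_def)
  have \<tau>_mem: "\<tau> s \<in> {0..L}" if "0 \<le> s" for s
  proof -
    have "0 \<le> \<tau> s" unfolding \<tau>_def by (rule cSup_upper[OF A0[OF that] bdd])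
    moreover have "\<tau> s \<le> L"
      unfolding \<tau>_def by (rule cSup_least) (use A0[OF that] in \<open>auto simp: A_def\<close>)
    ultimately show ?thesis by simp
  qed
  have above: "s < f t" if "\<tau> s < t" "t \<le> L" "0 \<le> s" for s t
  proof (rule ccontr)
    assume "\<not> s < f t"
    then have "t \<in> A s" using that \<tau>_mem[of s] by (auto simp: A_def)
    then show False using cSup_upper[OF _ bdd] that by (force simp: \<tau>_def)
  qed
  have below: "f t \<le> s" if t: "t < \<tau> s" "0 \<le> t" "0 \<le> s" for s t
  proof -
    have "\<exists>r\<in>A s. t < r" using t A0 unfolding \<tau>_def by (intro less_cSupD) auto
    then obtain r where "r \<in> A s" "t < r" by blast
    then show ?thesis using mono[of t r] t by (auto simp: A_def)
  qed
  have key: "mdist m (\<gamma> (\<tau> s)) (\<gamma> (\<tau> s')) \<le> s' - s" if s: "0 \<le> s" "s \<le> s'" for s s'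
  proof -
    have sub: "A s \<subseteq> A s'" using s by (auto simp: A_def)
    have le: "\<tau> s \<le> \<tau> s'"
      unfolding \<tau>_def using A0[of s] s bdd sub by (intro cSup_subset_mono) auto
    have mem: "\<tau> s \<in> {0..L}" "\<tau> s' \<in> {0..L}" using \<tau>_mem s by auto
    show ?thesis
    proof (cases "\<tau> s = \<tau> s'")
      case True
      then show ?thesis using mdist_self[OF path_between_mem[OF p mem(2)]] s by simp
    next
      case False
      then have lt: "\<tau> s < \<tau> s'" using le by simp
      show ?thesis
      proof (rule field_le_epsilon)
        fix e :: real assume e: "e > 0"
        obtain d1 where d1: "d1 > 0"
          "\<And>t. t \<in> {0..L} \<Longrightarrow> \<bar>t - \<tau> s\<bar> < d1 \<Longrightarrow> mdist m (\<gamma> (\<tau> s)) (\<gamma> t) < e / 2"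
          using path_between_near[OF p mem(1), of "e / 2"] e by auto
        obtain d2 where d2: "d2 > 0"
          "\<And>t. t \<in> {0..L} \<Longrightarrow> \<bar>t - \<tau> s'\<bar> < d2 \<Longrightarrow> mdist m (\<gamma> (\<tau> s')) (\<gamma> t) < e / 2"
          using path_between_near[OF p mem(2), of "e / 2"] e by auto
        \<comment> \<open>Both times are moved inwards by \<open>\<delta>\<close>, since
          \<open>f\<close> is not controlled at \<open>\<tau> s\<close> and \<open>\<tau> s'\<close>
          themselves. The moved times keep their order and satisfy \<open>s < f t\<close> and
          \<open>f t' \<le> s'\<close>, while each point moves by less than
          \<open>e / 2\<close>.\<close>
        define \<delta> where "\<delta> = min (min d1 d2) (\<tau> s' - \<tau> s) / 2"
        have \<delta>: "0 < \<delta>" "\<delta> < d1" "\<delta> < d2" "2 * \<delta> \<le> \<tau> s' - \<tau> s"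
          using d1(1) d2(1) lt by (auto simp: \<delta>_def min_def)
        define t where "t = \<tau> s + \<delta>"
        define t' where "t' = \<tau> s' - \<delta>"
        have tt: "t \<in> {0..L}" "t' \<in> {0..L}" "t \<le> t'" "\<tau> s < t" "t' < \<tau> s'"
          using \<delta> mem by (auto simp: t_def t'_def)
        have "mdist m (\<gamma> (\<tau> s)) (\<gamma> t) < e / 2" using d1(2)[OF tt(1)] \<delta> by (simp add: t_def)
        moreover have "mdist m (\<gamma> t') (\<gamma> (\<tau> s')) < e / 2"
          using d2(2)[OF tt(2)] \<delta> by (simp add: t'_def mdist_commute)
        moreover have "mdist m (\<gamma> t) (\<gamma> t') \<le> s' - s"
          using step[of t t'] above[of s t] below[of t' s'] tt s by auto
        moreover have "mdist m (\<gamma> (\<tau> s)) (\<gamma> (\<tau> s')) \<le>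
            mdist m (\<gamma> (\<tau> s)) (\<gamma> t) + (mdist m (\<gamma> t) (\<gamma> t') + mdist m (\<gamma> t') (\<gamma> (\<tau> s')))"
          using path_between_mem[OF p] mem tt
            mdist_triangle[of "\<gamma> (\<tau> s)" m "\<gamma> t" "\<gamma> (\<tau> s')"]
            mdist_triangle[of "\<gamma> t" m "\<gamma> t'" "\<gamma> (\<tau> s')"] by fastforce
        ultimately show "mdist m (\<gamma> (\<tau> s)) (\<gamma> (\<tau> s')) \<le> s' - s + e" by linarith
      qed
    qed
  qed
  \<comment> \<open>\<open>\<tau> 0\<close> is positive if the path first rests at \<open>x\<close>.
    Before \<open>\<tau> 0\<close> no length has been travelled, so the path is still at
    \<open>x\<close>, and continuity extends this to \<open>\<tau> 0\<close>.\<close>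
  have start: "\<gamma> (\<tau> 0) = x"
  proof -
    have mem: "\<tau> 0 \<in> {0..L}" using \<tau>_mem by simp
    have "mdist m (\<gamma> (\<tau> 0)) x \<le> 0"
    proof (rule field_le_epsilon)
      fix e :: real assume e: "e > 0"
      obtain d where d: "d > 0"
        "\<And>t. t \<in> {0..L} \<Longrightarrow> \<bar>t - \<tau> 0\<bar> < d \<Longrightarrow> mdist m (\<gamma> (\<tau> 0)) (\<gamma> t) < e"
        using path_between_near[OF p mem e] by auto
      define t where "t = max 0 (\<tau> 0 - d / 2)"
      have t: "t \<in> {0..L}" "\<bar>t - \<tau> 0\<bar> < d" using d mem by (auto simp: t_def)
      have "f t \<le> 0" using below[of t 0] f0 d(1) by (cases "t = 0") (auto simp: t_def max_def)
      then have "mdist m x (\<gamma> t) \<le> 0" using step[of 0 t] t f0 ends by auto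
      moreover have "mdist m (\<gamma> (\<tau> 0)) x \<le> mdist m (\<gamma> (\<tau> 0)) (\<gamma> t) + mdist m (\<gamma> t) x"
        using path_between_mem[OF p] mem t L ends by (intro mdist_triangle) auto
      ultimately show "mdist m (\<gamma> (\<tau> 0)) x \<le> 0 + e"
        using d(2)[OF t] by (simp add: mdist_commute)
    qed
    then have "mdist m (\<gamma> (\<tau> 0)) x = 0" by (simp add: antisym)
    then show ?thesis
      using mdist_zero[of "\<gamma> (\<tau> 0)" m x] path_between_mem[OF p] mem L ends by auto
  qed
  have finish: "\<tau> l = L"
  proof -
    have "L \<in> A l" using fin[of L] L by (auto simp: A_def)
    then have "L \<le> \<tau> l" using cSup_upper[OF _ bdd] by (simp add: \<tau>_def)
    then show ?thesis using \<tau>_mem[OF l0] by auto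
  qed
  have "lip_path m x y l (\<gamma> \<circ> \<tau>)"
    unfolding lip_path_def
  proof (intro conjI ballI)
    fix s t assume "s \<in> {0..l}" "t \<in> {0..l}"
    then show "mdist m ((\<gamma> \<circ> \<tau>) s) ((\<gamma> \<circ> \<tau>) t) \<le> \<bar>s - t\<bar>"
      using key[of s t] key[of t s] by (cases "s \<le> t") (auto simp: mdist_commute)
  qed (use l0 start finish ends \<tau>_mem path_between_mem[OF p] in auto)
  then show ?thesis by blast
qed

section \<open>Length spaces\<close>

text \<open>The strict inequality lets some path undercut the infimum, and its reparametrization can
  be spread over exactly \<open>[0,l]\<close>.\<close>

lemma length_space_lip_path:
  assumes "length_space m" "x \<in> mspace m" "y \<in> mspace m" "mdist m x y < l"
  shows "\<exists>g. lip_path m x y l g"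
proof -
  have "(INF (L, \<gamma>) \<in> {(L, \<gamma>). path_between m x y L \<gamma>}. path_len m \<gamma> 0 L) < ereal l"
    using assms unfolding length_space_def by (metis less_ereal.simps(1))
  then obtain L \<gamma> where "path_between m x y L \<gamma>" "path_len m \<gamma> 0 L < ereal l"
    by (auto simp: INF_less_iff)
  then show ?thesis using reparametrize by (metis less_imp_le)
qed

lemma length_spaceI:
  assumes "\<And>x y e. x \<in> mspace m \<Longrightarrow> y \<in> mspace m \<Longrightarrow> e > 0 \<Longrightarrow>
    \<exists>c g. lip_path m x y c g \<and> c \<le> mdist m x y + e"
  shows "length_space m"
  unfolding length_space_def
proof (intro ballI antisym)
  fix x y assume xy: "x \<in> mspace m" "y \<in> mspace m"
  let ?I = "INF (L, \<gamma>) \<in> {(L, \<gamma>). path_between m x y L \<gamma>}. path_len m \<gamma> 0 L"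
  show "ereal (mdist m x y) \<le> ?I"
    using mdist_le_path_len by (intro INF_greatest) (fastforce simp: path_between_def)
  show "?I \<le> ereal (mdist m x y)"
  proof (rule ereal_le_epsilon2)
    fix e :: real assume "e > 0"
    then obtain c g where g: "lip_path m x y c g" "c \<le> mdist m x y + e" using assms xy by blast
    then have "?I \<le> path_len m g 0 c"
      using lip_path_path_between by (intro INF_lower2[where i = "(c, g)"]) auto
    also have "\<dots> \<le> ereal c" by (rule lip_path_path_len[OF g(1)])
    also have "\<dots> \<le> ereal (mdist m x y) + ereal e" using g by simp
    finally show "?I \<le> ereal (mdist m x y) + ereal e" .
  qed
qed

text \<open>Nearly shortest paths in the factors are run simultaneously with speeds
  \<open>l1 / l\<close> and \<open>l2 / l\<close>. The squares of these speeds add up to 1, so the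
  product path is again 1-Lipschitz, and Minkowski's inequality bounds \<open>l\<close>.\<close>

lemma length_space_prod_metric:
  assumes "length_space X1" "length_space X2"
  shows "length_space (prod_metric X1 X2)"
proof (rule length_spaceI)
  fix x y and e :: real
  assume xy: "x \<in> mspace (prod_metric X1 X2)" "y \<in> mspace (prod_metric X1 X2)" and e: "e > 0"
  obtain x1 x2 y1 y2 where eq: "x = (x1, x2)" "y = (y1, y2)" by fastforce
  \<comment> \<open>The slack \<open>e / 2\<close> keeps both lengths positive even if the
    coordinates agree, so that division by \<open>l\<close> is possible.\<close>
  define l1 where "l1 = mdist X1 x1 y1 + e / 2"
  define l2 where "l2 = mdist X2 x2 y2 + e / 2"
  have pos: "l1 > 0" "l2 > 0"
    using e by (simp_all add: l1_def l2_def add_nonneg_pos)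
  obtain g1 where g1: "lip_path X1 x1 y1 l1 g1"
    using length_space_lip_path[OF assms(1), of x1 y1 l1] xy e by (auto simp: eq l1_def)
  obtain g2 where g2: "lip_path X2 x2 y2 l2 g2"
    using length_space_lip_path[OF assms(2), of x2 y2 l2] xy e by (auto simp: eq l2_def)
  define l where "l = sqrt (l1\<^sup>2 + l2\<^sup>2)"
  have l: "l > 0" "l\<^sup>2 = l1\<^sup>2 + l2\<^sup>2" using pos by (auto simp: l_def add_pos_pos)
  define g where "g t = (g1 (t * (l1 / l)), g2 (t * (l2 / l)))" for t
  have mem: "t * (l1 / l) \<in> {0..l1}" "t * (l2 / l) \<in> {0..l2}" if "t \<in> {0..l}" for t
    using that pos l by (auto simp: field_simps intro: mult_right_mono)
  have "lip_path (prod_metric X1 X2) x y l g"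
    unfolding lip_path_def
  proof (intro conjI ballI)
    fix s t assume st: "s \<in> {0..l}" "t \<in> {0..l}"
    have "mdist X1 (g1 (s * (l1 / l))) (g1 (t * (l1 / l))) \<le> \<bar>s * (l1 / l) - t * (l1 / l)\<bar>"
      using g1 mem st unfolding lip_path_def by blast
    moreover have "mdist X2 (g2 (s * (l2 / l))) (g2 (t * (l2 / l))) \<le> \<bar>s * (l2 / l) - t * (l2 / l)\<bar>"
      using g2 mem st unfolding lip_path_def by blast
    ultimately have "mdist (prod_metric X1 X2) (g s) (g t) \<le>
        sqrt ((s * (l1 / l) - t * (l1 / l))\<^sup>2 + (s * (l2 / l) - t * (l2 / l))\<^sup>2)"
      unfolding g_def
      by (auto simp: prod_dist_def simp flip: abs_le_square_iff intro!: add_mono)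
    also have "(s * (l1 / l) - t * (l1 / l))\<^sup>2 + (s * (l2 / l) - t * (l2 / l))\<^sup>2 =
        (s - t)\<^sup>2 * ((l1\<^sup>2 + l2\<^sup>2) / l\<^sup>2)"
      by (simp add: power2_eq_square add_divide_distrib algebra_simps)
    also have "\<dots> = (s - t)\<^sup>2" using l(1) by (simp flip: l(2))
    finally show "mdist (prod_metric X1 X2) (g s) (g t) \<le> \<bar>s - t\<bar>" by simp
  next
    show "g 0 = x" "g l = y" using g1 g2 l by (auto simp: g_def eq lip_path_def)
    show "g \<in> {0..l} \<rightarrow> mspace (prod_metric X1 X2)"
      using g1 g2 mem by (auto simp: g_def lip_path_def Pi_iff)
  qed (use l in auto)
  moreover have "l \<le> mdist (prod_metric X1 X2) x y + e"
  proof -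
    have "l \<le> sqrt ((mdist X1 x1 y1)\<^sup>2 + (mdist X2 x2 y2)\<^sup>2) + sqrt ((e / 2)\<^sup>2 + (e / 2)\<^sup>2)"
      unfolding l_def l1_def l2_def by (rule real_sqrt_sum_squares_triangle_ineq)
    also have "sqrt ((e / 2)\<^sup>2 + (e / 2)\<^sup>2) \<le> e / 2 + e / 2"
      using e by (intro sqrt_sum_squares_le_sum) auto
    finally show ?thesis by (simp add: eq prod_dist_def)
  qed
  ultimately show "\<exists>c g. lip_path (prod_metric X1 X2) x y c g \<and>
      c \<le> mdist (prod_metric X1 X2) x y + e" by blast
qed

text \<open>Two-sided control of the length: \<open>hi\<close> bounds it from above through the
  parameter interval, \<open>lo\<close> bounds it from below. Both bounds add up under
  concatenation.\<close>

definition lip_between :: "'a metric \<Rightarrow> 'a \<Rightarrow> 'a \<Rightarrow> real \<Rightarrow> real \<Rightarrow> bool" where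
  "lip_between m x y lo hi \<longleftrightarrow>
     (\<exists>c g. lip_path m x y c g \<and> c \<le> hi \<and> ereal lo \<le> path_len m g 0 c)"

text \<open>The junction time \<open>t\<close> is kept, because comparison points refer to the
  lengths of the two subpaths separately.\<close>

lemma lip_between_joinE:
  assumes "lip_between m x y lo hi" "lip_between m y z lo' hi'"
  obtains K g t where "lip_path m x z K g" "K \<le> hi + hi'" "t \<in> {0..K}" "g t = y"
    "ereal lo \<le> path_len m g 0 t" "ereal lo' \<le> path_len m g t K"
proof -
  obtain c1 g1 where 1: "lip_path m x y c1 g1" "c1 \<le> hi" "ereal lo \<le> path_len m g1 0 c1"
    using assms(1) by (auto simp: lip_between_def)
  obtain c2 g2 where 2: "lip_path m y z c2 g2" "c2 \<le> hi'" "ereal lo' \<le> path_len m g2 0 c2"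
    using assms(2) by (auto simp: lip_between_def)
  let ?g = "\<lambda>t. if t \<le> c1 then g1 t else g2 (t - c1)"
  have ends: "0 \<le> c1" "0 \<le> c2" "g1 c1 = y" "g2 0 = y" using 1 2 by (auto simp: lip_path_def)
  show ?thesis
  proof (rule that)
    show "lip_path m x z (c1 + c2) ?g" using 1(1) 2(1) by (rule lip_path_join)
    show "ereal lo \<le> path_len m ?g 0 c1"
      using path_len_shift_le[of 0 c1 ?g 0 g1 m] 1(3) by auto
    have "?g (t + c1) = g2 t" if "t \<in> {0..c2}" for t
      using that ends by auto
    then show "ereal lo' \<le> path_len m ?g c1 (c1 + c2)"
      using path_len_shift_le[of 0 c2 ?g c1 g2 m] 2(3) by (simp add: add.commute)
  qed (use 1 2 ends in auto)
qed

lemma lip_between_trans: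
  assumes "lip_between m x y lo hi" "lip_between m y z lo' hi'"
  shows "lip_between m x z (lo + lo') (hi + hi')"
proof -
  obtain K g t where g: "lip_path m x z K g" "K \<le> hi + hi'" "t \<in> {0..K}" "g t = y"
    "ereal lo \<le> path_len m g 0 t" "ereal lo' \<le> path_len m g t K"
    using assms by (rule lip_between_joinE)
  have "ereal (lo + lo') = ereal lo + ereal lo'" by simp
  also have "\<dots> \<le> path_len m g 0 t + path_len m g t K" using g by (intro add_mono)
  also have "\<dots> \<le> path_len m g 0 K" using g by (intro path_len_superadditive) auto
  finally show ?thesis using g unfolding lip_between_def by blast
qed

lemma lip_between_mdist:
  assumes "length_space m" "x \<in> mspace m" "y \<in> mspace m" "mdist m x y < hi"
  shows "lip_between m x y (mdist m x y) hi"
proof -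
  obtain g where g: "lip_path m x y hi g" using length_space_lip_path[OF assms] by blast
  have "ereal (mdist m (g 0) (g hi)) \<le> path_len m g 0 hi"
    using g by (intro mdist_le_path_len) (auto simp: lip_path_def)
  then show ?thesis using g unfolding lip_between_def lip_path_def by auto
qed

text \<open>The intermediate value theorem for the distance from \<open>u\<close> along a path to
  \<open>w\<close>. It supplies the turning point of a loop at \<open>u\<close> of prescribed
  size.\<close>

lemma length_space_sphere:
  assumes "length_space m" "u \<in> mspace m" "w \<in> mspace m" "0 \<le> r" "r \<le> mdist m u w"
  obtains v where "v \<in> mspace m" "mdist m u v = r"
proof -
  obtain c g where g: "lip_path m u w c g"
    using length_space_lip_path[OF assms(1-3), of "mdist m u w + 1"] by auto
  then have mem: "g t \<in> mspace m" if "t \<in> {0..c}" for t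
    using that by (auto simp: lip_path_def)
  have lip: "mdist m u (g s) - mdist m u (g t) \<le> \<bar>s - t\<bar>" if "s \<in> {0..c}" "t \<in> {0..c}" for s t
  proof -
    have "mdist m (g t) (g s) \<le> \<bar>t - s\<bar>" using g that unfolding lip_path_def by blast
    then show ?thesis
      using mdist_triangle[OF assms(2) mem[OF that(2)] mem[OF that(1)]] by linarith
  qed
  have "1-lipschitz_on {0..c} (\<lambda>t. mdist m u (g t))"
  proof (rule lipschitz_onI)
    fix s t assume "s \<in> {0..c}" "t \<in> {0..c}"
    then show "dist (mdist m u (g s)) (mdist m u (g t)) \<le> 1 * dist s t"
      using lip[of s t] lip[of t s] by (auto simp: dist_real_def)
  qed simp
  then have "continuous_on {0..c} (\<lambda>t. mdist m u (g t))" by (rule lipschitz_on_continuous_on)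
  moreover have "mdist m u (g 0) \<le> r" "r \<le> mdist m u (g c)" "0 \<le> c"
    using g assms by (auto simp: lip_path_def mdist_self simp del: mdist_zero)
  ultimately obtain t where "0 \<le> t" "t \<le> c" "mdist m u (g t) = r"
    using IVT'[of "\<lambda>t. mdist m u (g t)" 0 r c] by blast
  then show ?thesis using that mem[of t] by auto
qed

text \<open>A point \<open>u\<close> that nearly divides \<open>[x,y]\<close> in the ratio \<open>a : 1 - a\<close> lies on a short segment for
  which the point exactly in that ratio is an admissible comparison point.  The segment runs twice
  around a short loop at \<open>u\<close> and \<open>u\<close> is taken between the two rounds, which lengthens both
  subpaths; this is why no error term survives in the product.\<close>

lemma short_segment_through:
  assumes m: "length_space m" and xy: "x \<in> mspace m" "y \<in> mspace m" and e: "e > 0"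
  shows "\<exists>s>0. \<forall>u\<in>mspace m. \<forall>a.
    mdist m x u \<le> a * mdist m x y + s \<longrightarrow> mdist m u y \<le> (1 - a) * mdist m x y + s \<longrightarrow>
    (\<exists>K g t. short_segment m e x y K g \<and> t \<in> {0..K} \<and> g t = u \<and>
      ereal (a * mdist m x y) \<le> path_len m g 0 t \<and>
      ereal ((1 - a) * mdist m x y) \<le> path_len m g t K)"
proof -
  define D where "D = mdist m x y"
  \<comment> \<open>The upper bounds of the two pieces make the joined path short, and the lower
    bounds make the point in the ratio \<open>a : 1 - a\<close> admissible.\<close>
  have segment: "\<exists>K g t. short_segment m e x y K g \<and> t \<in> {0..K} \<and> g t = u \<and>
      ereal (a * D) \<le> path_len m g 0 t \<and> ereal ((1 - a) * D) \<le> path_len m g t K"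
    if b: "lip_between m x u lo hi" "lip_between m u y lo' hi'"
      and le: "hi + hi' \<le> D + e" "a * D \<le> lo" "(1 - a) * D \<le> lo'" for u a lo hi lo' hi'
  proof -
    obtain K g t where g: "lip_path m x y K g" "K \<le> hi + hi'" "t \<in> {0..K}" "g t = u"
      "ereal lo \<le> path_len m g 0 t" "ereal lo' \<le> path_len m g t K"
      using b by (rule lip_between_joinE)
    have "path_len m g 0 K \<le> ereal K" by (rule lip_path_path_len[OF g(1)])
    also have "\<dots> \<le> ereal (D + e)" using g le by simp
    finally have "short_segment m e x y K g"
      using lip_path_path_between[OF g(1)] by (simp add: short_segment_def D_def)
    moreover have "ereal (a * D) \<le> path_len m g 0 t" "ereal ((1 - a) * D) \<le> path_len m g t K"
      using g(5,6) le by (meson ereal_less_eq(3) order_trans)+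
    ultimately show ?thesis using g by blast
  qed
  have tri: "D \<le> mdist m x u + mdist m u y" if "u \<in> mspace m" for u
    using mdist_triangle[of x m u y] that xy by (simp add: D_def)
  \<comment> \<open>The budget is \<open>12 * \<eta>\<close>: the two approximations to distances
    cost \<open>2 * \<eta>\<close>, the two rounds of the loop at most \<open>8 * \<eta>\<close>,
    and the detour through \<open>u\<close> at most \<open>2 * \<eta>\<close>. The bound
    \<open>D / 2\<close> makes room for the loop. For \<open>D = 0\<close> the space may be a single
    point, and no loop is used.\<close>
  define \<eta> where "\<eta> = (if D = 0 then e / 12 else min (D / 2) (e / 12))"
  have \<eta>: "\<eta> > 0" "12 * \<eta> \<le> e" "D \<noteq> 0 \<Longrightarrow> \<eta> \<le> D / 2"
    using e mdist_nonneg[of m x y] by (simp_all add: \<eta>_def D_def min_def del: mdist_nonneg)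
  have "\<exists>K g t. short_segment m e x y K g \<and> t \<in> {0..K} \<and> g t = u \<and>
      ereal (a * D) \<le> path_len m g 0 t \<and> ereal ((1 - a) * D) \<le> path_len m g t K"
    if u: "u \<in> mspace m" and le: "mdist m x u \<le> a * D + \<eta>" "mdist m u y \<le> (1 - a) * D + \<eta>"
    for u a
  proof -
    have sum: "a * D + (1 - a) * D = D" by (simp add: algebra_simps)
    have xu: "lip_between m x u (mdist m x u) (mdist m x u + \<eta>)"
      using \<eta> by (intro lip_between_mdist m xy u) simp
    have uy: "lip_between m u y (mdist m u y) (mdist m u y + \<eta>)"
      using \<eta> by (intro lip_between_mdist m xy u) simp
    show ?thesis
    proof (cases "D = 0")
      case True
      then show ?thesis using sum le \<eta> by (intro segment[OF xu uy]) auto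
    next
      case False
      \<comment> \<open>One of the two ends is at distance at least \<open>D / 2\<close> from
        \<open>u\<close>; a path towards it meets a point at distance exactly
        \<open>\<eta>\<close>.\<close>
      then have "\<eta> \<le> mdist m u x \<or> \<eta> \<le> mdist m u y"
        using tri[OF u] \<eta>(3) mdist_commute[of m x u] by linarith
      then obtain v where v: "v \<in> mspace m" "mdist m u v = \<eta>"
        using length_space_sphere[OF m u] xy \<eta>(1) by (metis less_imp_le)
      have uv: "lip_between m u v \<eta> (2 * \<eta>)"
        using lip_between_mdist[OF m u v(1), of "2 * \<eta>"] v \<eta> by simp
      have vu: "lip_between m v u \<eta> (2 * \<eta>)"
        using lip_between_mdist[OF m v(1) u, of "2 * \<eta>"] v \<eta> by (simp add: mdist_commute)
      \<comment> \<open>Each round has length at least \<open>2 * \<eta>\<close>, while the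
        distances to \<open>u\<close> fall short of \<open>a * D\<close> and
        \<open>(1 - a) * D\<close> by at most \<open>\<eta>\<close>.\<close>
      note loop = lip_between_trans[OF uv vu]
      show ?thesis
        by (rule segment[OF lip_between_trans[OF xu loop] lip_between_trans[OF loop uy]])
          (use sum le \<eta> tri[OF u] in linarith)+
    qed
  qed
  then show ?thesis using \<eta>(1) unfolding D_def by blast
qed

section \<open>Euclidean triangles\<close>

text \<open>The law of cosines gives the coordinate \<open>p\<close> of the foot of the altitude
  from \<open>z\<close> on the line through \<open>x\<close> and \<open>y\<close>. The triangle
  inequalities amount to \<open>\<bar>p\<bar> \<le> b\<close>, so that the height is real.\<close>

lemma exists_plane_triangle:
  fixes a b c :: real
  assumes "0 \<le> c" "a \<le> b + c" "b \<le> a + c" "c \<le> a + b"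
  obtains x y z :: "real^2" where "dist x y = c" "dist y z = a" "dist z x = b"
proof -
  have ab: "0 \<le> a" "0 \<le> b" using assms by linarith+
  \<comment> \<open>For \<open>c = 0\<close> the hypotheses force \<open>a = b\<close>, and any
    \<open>p\<close> with \<open>\<bar>p\<bar> \<le> b\<close> would do.\<close>
  define p where "p = (if c = 0 then 0 else (b\<^sup>2 + c\<^sup>2 - a\<^sup>2) / (2 * c))"
  have p: "2 * p * c = b\<^sup>2 + c\<^sup>2 - a\<^sup>2" using assms by (auto simp: p_def)
  have "p\<^sup>2 \<le> b\<^sup>2"
  proof (cases "c = 0")
    case False
    then have c: "c > 0" using assms by simp
    have "2 * c * p \<le> 2 * c * b"
    proof -
      have "\<bar>b - c\<bar> \<le> \<bar>a\<bar>" using assms by linarith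
      then have "(b - c)\<^sup>2 \<le> a\<^sup>2" by (simp only: abs_le_square_iff)
      then show ?thesis using p by (simp add: power2_eq_square algebra_simps)
    qed
    moreover have "2 * c * (- b) \<le> 2 * c * p"
    proof -
      have "\<bar>a\<bar> \<le> \<bar>b + c\<bar>" using assms ab by linarith
      then have "a\<^sup>2 \<le> (b + c)\<^sup>2" by (simp only: abs_le_square_iff)
      then show ?thesis using p by (simp add: power2_eq_square algebra_simps)
    qed
    ultimately have "p \<le> b" "- b \<le> p" using c by (auto simp only: mult_le_cancel_left_pos)
    then have "\<bar>p\<bar> \<le> \<bar>b\<bar>" by linarith
    then show ?thesis by (simp only: abs_le_square_iff)
  qed (simp add: p_def)
  then have q: "(sqrt (b\<^sup>2 - p\<^sup>2))\<^sup>2 = b\<^sup>2 - p\<^sup>2" by simp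
  show ?thesis
  proof (rule that[of "vector [0, 0]" "vector [c, 0]" "vector [p, sqrt (b\<^sup>2 - p\<^sup>2)]"])
    show "dist (vector [0, 0] :: real^2) (vector [c, 0]) = c"
      using assms by (simp add: dist_vec_def L2_set_def sum_2 dist_real_def)
    have "(c - p)\<^sup>2 + (b\<^sup>2 - p\<^sup>2) = a\<^sup>2"
      using p by (simp add: power2_eq_square algebra_simps)
    then show "dist (vector [c, 0] :: real^2) (vector [p, sqrt (b\<^sup>2 - p\<^sup>2)]) = a"
      using ab q by (simp add: dist_vec_def L2_set_def sum_2 dist_real_def)
    show "dist (vector [p, sqrt (b\<^sup>2 - p\<^sup>2)] :: real^2) (vector [0, 0]) = b"
      using ab q by (simp add: dist_vec_def L2_set_def sum_2 dist_real_def)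
  qed
qed

lemma exists_comparison_triangle:
  assumes "x \<in> mspace m" "y \<in> mspace m" "z \<in> mspace m"
  obtains x' y' z' where "comparison_triangle m x y z x' y' z'"
proof -
  have "mdist m y z \<le> mdist m z x + mdist m x y" "mdist m z x \<le> mdist m y z + mdist m x y"
    "mdist m x y \<le> mdist m y z + mdist m z x"
    using mdist_triangle[of y m x z] mdist_triangle[of z m y x] mdist_triangle[of x m z y] assms
    by (auto simp: mdist_commute)
  then obtain x' y' z' :: "real^2" where
    "dist x' y' = mdist m x y" "dist y' z' = mdist m y z" "dist z' x' = mdist m z x"
    by (rule exists_plane_triangle[OF mdist_nonneg])
  then show ?thesis using that by (auto simp: comparison_triangle_def)
qed

lemma dist_convex_combination:
  fixes x y :: "'a::real_normed_vector"
  assumes "0 \<le> a" "a \<le> 1"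
  shows "dist x ((1 - a) *\<^sub>R x + a *\<^sub>R y) = a * dist x y"
    and "dist ((1 - a) *\<^sub>R x + a *\<^sub>R y) y = (1 - a) * dist x y"
proof -
  have "x - ((1 - a) *\<^sub>R x + a *\<^sub>R y) = a *\<^sub>R (x - y)"
    "(1 - a) *\<^sub>R x + a *\<^sub>R y - y = (1 - a) *\<^sub>R (x - y)" by (simp_all add: algebra_simps)
  then show "dist x ((1 - a) *\<^sub>R x + a *\<^sub>R y) = a * dist x y"
    "dist ((1 - a) *\<^sub>R x + a *\<^sub>R y) y = (1 - a) * dist x y"
    using assms by (simp_all add: dist_norm)
qed

text \<open>The right-hand side is linear in the squared side lengths, hence additive under
  \<open>l\<^sup>2\<close>-products.\<close>

lemma dist_sq_between_sides:
  fixes x y z :: "'a::real_inner"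
  shows "(dist ((1 - a) *\<^sub>R x + a *\<^sub>R y) ((1 - b) *\<^sub>R y + b *\<^sub>R z))\<^sup>2 =
    (1 - a) * (1 - a - b) * (dist x y)\<^sup>2 + b * (a + b - 1) * (dist y z)\<^sup>2 +
    (1 - a) * b * (dist z x)\<^sup>2"
proof -
  \<comment> \<open>With \<open>y\<close> as origin, the only mixed term is the inner product of
    \<open>p\<close> and \<open>q\<close>, which polarization expresses by the three side
    lengths.\<close>
  define p q where "p = x - y" and "q = z - y"
  have "(1 - a) *\<^sub>R x + a *\<^sub>R y - ((1 - b) *\<^sub>R y + b *\<^sub>R z) = (1 - a) *\<^sub>R p - b *\<^sub>R q"
    "x - y = p" "y - z = - q" "z - x = q - p"
    by (simp_all add: p_def q_def algebra_simps)
  then show ?thesis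
    unfolding dist_norm power2_norm_eq_inner
    by (simp add: inner_diff_left inner_diff_right inner_commute[of q p] algebra_simps)
qed

section \<open>Comparison of points\<close>

text \<open>The triangle condition in terms of distances alone. It applies to the coordinates of
  points on a side in the product, whether or not the projected side is short: the segments through
  \<open>u\<close> and \<open>v\<close> are built anew by
  \<open>short_segment_through\<close>.\<close>

lemma rCAT0_star_points:
  assumes m: "rCAT0_star C m" and xyz: "x \<in> mspace m" "y \<in> mspace m" "z \<in> mspace m"
  shows "\<exists>s>0. \<forall>u\<in>mspace m. \<forall>v\<in>mspace m. \<forall>a\<in>{0..1}. \<forall>b\<in>{0..1}. \<forall>x' y' z'.
    mdist m x u \<le> a * mdist m x y + s \<longrightarrow> mdist m u y \<le> (1 - a) * mdist m x y + s \<longrightarrow>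
    mdist m y v \<le> b * mdist m y z + s \<longrightarrow> mdist m v z \<le> (1 - b) * mdist m y z + s \<longrightarrow>
    comparison_triangle m x y z x' y' z' \<longrightarrow>
    mdist m u v \<le> dist ((1 - a) *\<^sub>R x' + a *\<^sub>R y') ((1 - b) *\<^sub>R y' + b *\<^sub>R z') + C"
proof -
  have len: "length_space m" using m by (simp add: rCAT0_star_def)
  obtain h where h: "h > 0" and cmp: "\<And>L1 \<gamma>1 L2 \<gamma>2 L3 \<gamma>3 x' y' z'.
    short_segment m h x y L1 \<gamma>1 \<Longrightarrow> short_segment m h y z L2 \<gamma>2 \<Longrightarrow>
    short_segment m h z x L3 \<gamma>3 \<Longrightarrow> comparison_triangle m x y z x' y' z' \<Longrightarrow>
    sides_compare m C L1 \<gamma>1 x' y' L2 \<gamma>2 y' z'"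
  proof -
    obtain H where H: "\<forall>x\<in>mspace m. \<forall>y\<in>mspace m. \<forall>z\<in>mspace m. 0 < H x y z \<and>
      (\<forall>L1 \<gamma>1 L2 \<gamma>2 L3 \<gamma>3 x' y' z'.
        short_segment m (H x y z) x y L1 \<gamma>1 \<longrightarrow> short_segment m (H x y z) y z L2 \<gamma>2 \<longrightarrow>
        short_segment m (H x y z) z x L3 \<gamma>3 \<longrightarrow> comparison_triangle m x y z x' y' z' \<longrightarrow>
        sides_compare m C L1 \<gamma>1 x' y' L2 \<gamma>2 y' z' \<and>
        sides_compare m C L2 \<gamma>2 y' z' L3 \<gamma>3 z' x' \<and>
        sides_compare m C L3 \<gamma>3 z' x' L1 \<gamma>1 x' y')"
      using m unfolding rCAT0_star_def by (elim conjE exE) (rule that)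
    show ?thesis
      by (rule that[of "H x y z"]) (use bspec[OF bspec[OF bspec[OF H xyz(1)] xyz(2)] xyz(3)] in blast)+
  qed
  obtain s1 where s1: "s1 > 0" "\<forall>u\<in>mspace m. \<forall>a.
    mdist m x u \<le> a * mdist m x y + s1 \<longrightarrow> mdist m u y \<le> (1 - a) * mdist m x y + s1 \<longrightarrow>
    (\<exists>K g t. short_segment m h x y K g \<and> t \<in> {0..K} \<and> g t = u \<and>
      ereal (a * mdist m x y) \<le> path_len m g 0 t \<and>
      ereal ((1 - a) * mdist m x y) \<le> path_len m g t K)"
    using short_segment_through[OF len xyz(1,2) h] by (elim exE conjE) (rule that)
  obtain s2 where s2: "s2 > 0" "\<forall>u\<in>mspace m. \<forall>a.
    mdist m y u \<le> a * mdist m y z + s2 \<longrightarrow> mdist m u z \<le> (1 - a) * mdist m y z + s2 \<longrightarrow>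
    (\<exists>K g t. short_segment m h y z K g \<and> t \<in> {0..K} \<and> g t = u \<and>
      ereal (a * mdist m y z) \<le> path_len m g 0 t \<and>
      ereal ((1 - a) * mdist m y z) \<le> path_len m g t K)"
    using short_segment_through[OF len xyz(2,3) h] by (elim exE conjE) (rule that)
  \<comment> \<open>The third side carries neither \<open>u\<close> nor \<open>v\<close>; any short
    segment completes the triangle.\<close>
  obtain L3 \<gamma>3 where 3: "short_segment m h z x L3 \<gamma>3"
  proof -
    obtain g where g: "lip_path m z x (mdist m z x + h) g"
      using length_space_lip_path[OF len xyz(3,1), of "mdist m z x + h"] h by auto
    then show ?thesis
      using that lip_path_path_len[OF g] lip_path_path_between[OF g]
      unfolding short_segment_def by blast
  qed
  have "mdist m u v \<le> dist ((1 - a) *\<^sub>R x' + a *\<^sub>R y') ((1 - b) *\<^sub>R y' + b *\<^sub>R z') + C"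
    if uv: "u \<in> mspace m" "v \<in> mspace m" and ab: "a \<in> {0..1}" "b \<in> {0..1}"
      and u: "mdist m x u \<le> a * mdist m x y + min s1 s2"
        "mdist m u y \<le> (1 - a) * mdist m x y + min s1 s2"
      and v: "mdist m y v \<le> b * mdist m y z + min s1 s2"
        "mdist m v z \<le> (1 - b) * mdist m y z + min s1 s2"
      and tri: "comparison_triangle m x y z x' y' z'"
    for u v a b x' y' z'
  proof -
    have near: "mdist m x u \<le> a * mdist m x y + s1" "mdist m u y \<le> (1 - a) * mdist m x y + s1"
      "mdist m y v \<le> b * mdist m y z + s2" "mdist m v z \<le> (1 - b) * mdist m y z + s2"
      using u v min.cobounded1[of s1 s2] min.cobounded2[of s1 s2] by linarith+
    obtain K1 g1 t1 where g1: "short_segment m h x y K1 g1" "t1 \<in> {0..K1}" "g1 t1 = u"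
      "ereal (a * mdist m x y) \<le> path_len m g1 0 t1"
      "ereal ((1 - a) * mdist m x y) \<le> path_len m g1 t1 K1"
      using s1(2)[rule_format, OF uv(1) near(1,2)] by blast
    obtain K2 g2 t2 where g2: "short_segment m h y z K2 g2" "t2 \<in> {0..K2}" "g2 t2 = v"
      "ereal (b * mdist m y z) \<le> path_len m g2 0 t2"
      "ereal ((1 - b) * mdist m y z) \<le> path_len m g2 t2 K2"
      using s2(2)[rule_format, OF uv(2) near(3,4)] by blast
    have "comparison_point m K1 g1 x' y' t1 ((1 - a) *\<^sub>R x' + a *\<^sub>R y')"
      using g1 ab tri unfolding comparison_point_def comparison_triangle_def
      by (auto simp: dist_convex_combination in_segment)
    moreover have "comparison_point m K2 g2 y' z' t2 ((1 - b) *\<^sub>R y' + b *\<^sub>R z')"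
      using g2 ab tri unfolding comparison_point_def comparison_triangle_def
      by (auto simp: dist_convex_combination in_segment)
    ultimately show ?thesis
      using cmp[OF g1(1) g2(1) 3 tri] g1(2,3) g2(2,3) unfolding sides_compare_def by blast
  qed
  then show ?thesis using s1(1) s2(1) by (intro exI[of _ "min s1 s2"]) simp
qed

section \<open>From short segments in the product to ratios in the factors\<close>

lemma short_segment_mono:
  assumes "short_segment m h x y L \<gamma>" "h \<le> h'"
  shows "short_segment m h' x y L \<gamma>"
  using assms order_trans[of "path_len m \<gamma> 0 L" "ereal (mdist m x y + h)" "ereal (mdist m x y + h')"]
  by (simp add: short_segment_def)

text \<open>The two subpaths together have length at most \<open>mdist m x y + h\<close>. A
  comparison point forces one of them to have at least its share \<open>a\<close> or
  \<open>1 - a\<close> of \<open>mdist m x y\<close>, and what remains for the other bounds the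
  distance to \<open>\<gamma> t\<close>.\<close>

lemma comparison_point_ratio:
  assumes "short_segment m h x y K \<gamma>" "t \<in> {0..K}" "comparison_point m K \<gamma> x' y' t u'"
    "dist x' y' = mdist m x y"
  obtains a where "a \<in> {0..1}" "u' = (1 - a) *\<^sub>R x' + a *\<^sub>R y'"
    "mdist m x (\<gamma> t) \<le> a * mdist m x y + h" "mdist m (\<gamma> t) y \<le> (1 - a) * mdist m x y + h"
proof -
  have p: "\<gamma> 0 = x" "\<gamma> K = y" "0 \<le> K"
    and short: "path_len m \<gamma> 0 K \<le> ereal (mdist m x y + h)"
    using assms(1) by (auto simp: short_segment_def path_between_def)
  obtain a where a: "a \<in> {0..1}" "u' = (1 - a) *\<^sub>R x' + a *\<^sub>R y'"
    using assms(3) by (auto simp: comparison_point_def in_segment)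
  have c: "ereal (a * mdist m x y) \<le> path_len m \<gamma> 0 t" "ereal ((1 - a) * mdist m x y) \<le> path_len m \<gamma> t K"
    using assms(3,4) a by (auto simp: comparison_point_def dist_convex_combination)
  have add: "path_len m \<gamma> 0 t + path_len m \<gamma> t K \<le> ereal (mdist m x y + h)"
    using path_len_superadditive[of 0 t K m \<gamma>] assms(2) short by (auto intro: order_trans)
  have d: "ereal (mdist m x (\<gamma> t)) \<le> path_len m \<gamma> 0 t" "ereal (mdist m (\<gamma> t) y) \<le> path_len m \<gamma> t K"
    using mdist_le_path_len[of 0 t m \<gamma>] mdist_le_path_len[of t K m \<gamma>] assms(2) p by auto
  have "ereal (mdist m x (\<gamma> t) + (1 - a) * mdist m x y) \<le> ereal (mdist m x y + h)"
    using order_trans[OF add_mono[OF d(1) c(2)] add] by simp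
  moreover have "ereal (a * mdist m x y + mdist m (\<gamma> t) y) \<le> ereal (mdist m x y + h)"
    using order_trans[OF add_mono[OF c(1) d(2)] add] by simp
  ultimately show ?thesis using a by (intro that) (auto simp: algebra_simps)
qed

text \<open>With \<open>P = (P1,P2)\<close> and similarly \<open>Q, D\<close>: the Cauchy--Schwarz bound on \<open>Q \<bullet> D\<close> makes \<open>P \<bullet> D\<close>
  large, so \<open>\<bar>P - a D\<bar>\<^sup>2 = \<bar>P\<bar>\<^sup>2 - 2 a (P \<bullet> D) + a\<^sup>2 \<bar>D\<bar>\<^sup>2\<close> is at most \<open>h\<^sup>2 + 4 a h \<bar>D\<bar>\<close>.\<close>

lemma coordinates_near_ratio:
  fixes a h s d :: real
  assumes a: "0 \<le> a" "a \<le> 1" and nonneg: "0 \<le> h" "0 \<le> s" "0 \<le> D1" "0 \<le> D2" "0 \<le> d"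
    and d: "d\<^sup>2 = D1\<^sup>2 + D2\<^sup>2"
    and tri: "D1 \<le> P1 + Q1" "D2 \<le> P2 + Q2"
    and P: "sqrt (P1\<^sup>2 + P2\<^sup>2) \<le> a * d + h" and Q: "sqrt (Q1\<^sup>2 + Q2\<^sup>2) \<le> (1 - a) * d + h"
    and s: "h\<^sup>2 + 4 * d * h \<le> s\<^sup>2"
  shows "P1 \<le> a * D1 + s \<and> P2 \<le> a * D2 + s"
proof -
  have dd: "d = sqrt (D1\<^sup>2 + D2\<^sup>2)" using d nonneg by (metis real_sqrt_unique)
  have "Q1 * D1 + Q2 * D2 \<le> sqrt (Q1\<^sup>2 + Q2\<^sup>2) * d"
  proof -
    \<comment> \<open>Lagrange's identity: the two sides differ by the square of
      \<open>Q1 * D2 - Q2 * D1\<close>.\<close>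
    have "(Q1 * D1 + Q2 * D2)\<^sup>2 \<le> (Q1\<^sup>2 + Q2\<^sup>2) * (D1\<^sup>2 + D2\<^sup>2)"
      using zero_le_power2[of "Q1 * D2 - Q2 * D1"] by (simp add: power2_eq_square algebra_simps)
    then show ?thesis unfolding dd by (metis real_le_rsqrt real_sqrt_mult)
  qed
  also have "\<dots> \<le> ((1 - a) * d + h) * d" using Q nonneg by (intro mult_right_mono)
  finally have QD: "Q1 * D1 + Q2 * D2 \<le> ((1 - a) * d + h) * d" .
  have "d\<^sup>2 \<le> (P1 + Q1) * D1 + (P2 + Q2) * D2"
    using mult_right_mono[OF tri(1) nonneg(3)] mult_right_mono[OF tri(2) nonneg(4)]
    using d unfolding power2_eq_square by linarith
  then have "a * d\<^sup>2 - h * d \<le> P1 * D1 + P2 * D2"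
    using QD by (simp add: power2_eq_square algebra_simps)
  then have PD: "a * (a * d\<^sup>2 - h * d) \<le> a * (P1 * D1 + P2 * D2)" using a by (intro mult_left_mono)
  have "P1\<^sup>2 + P2\<^sup>2 \<le> (a * d + h)\<^sup>2" using P by (rule sqrt_le_D)
  moreover have "(P1 - a * D1)\<^sup>2 + (P2 - a * D2)\<^sup>2 =
      (P1\<^sup>2 + P2\<^sup>2) - 2 * (a * (P1 * D1 + P2 * D2)) + a\<^sup>2 * d\<^sup>2"
    unfolding d by (simp add: power2_eq_square algebra_simps)
  ultimately have "(P1 - a * D1)\<^sup>2 + (P2 - a * D2)\<^sup>2 \<le>
      (a * d + h)\<^sup>2 - 2 * (a * (a * d\<^sup>2 - h * d)) + a\<^sup>2 * d\<^sup>2"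
    using PD by linarith
  also have "\<dots> = h\<^sup>2 + 4 * (a * (d * h))" by (simp add: power2_eq_square algebra_simps)
  also have "\<dots> \<le> s\<^sup>2"
    using s mult_right_mono[OF a(2), of "d * h"] nonneg by (simp add: mult.assoc)
  finally have le: "(P1 - a * D1)\<^sup>2 + (P2 - a * D2)\<^sup>2 \<le> s\<^sup>2" .
  have "(P1 - a * D1)\<^sup>2 \<le> s\<^sup>2" "(P2 - a * D2)\<^sup>2 \<le> s\<^sup>2"
    using le zero_le_power2[of "P1 - a * D1"] zero_le_power2[of "P2 - a * D2"] by linarith+
  then have "P1 - a * D1 \<le> s" "P2 - a * D2 \<le> s" using nonneg(2) power2_le_imp_le by blast+
  then show ?thesis by simp
qed

text \<open>The second claim is the first one with the ends of the side exchanged and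
  \<open>1 - a\<close> in place of \<open>a\<close>.\<close>

lemma prod_metric_near_ratio:
  assumes mem: "(x1, x2) \<in> mspace (prod_metric X1 X2)" "(y1, y2) \<in> mspace (prod_metric X1 X2)"
      "(u1, u2) \<in> mspace (prod_metric X1 X2)"
    and a: "a \<in> {0..1}" and h: "0 \<le> h" "0 \<le> s"
    and d: "d = mdist (prod_metric X1 X2) (x1, x2) (y1, y2)"
    and u: "mdist (prod_metric X1 X2) (x1, x2) (u1, u2) \<le> a * d + h"
      "mdist (prod_metric X1 X2) (u1, u2) (y1, y2) \<le> (1 - a) * d + h"
    and s: "h\<^sup>2 + 4 * d * h \<le> s\<^sup>2"
  shows "mdist X1 x1 u1 \<le> a * mdist X1 x1 y1 + s \<and> mdist X2 x2 u2 \<le> a * mdist X2 x2 y2 + s"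
    and "mdist X1 u1 y1 \<le> (1 - a) * mdist X1 x1 y1 + s \<and>
      mdist X2 u2 y2 \<le> (1 - a) * mdist X2 x2 y2 + s"
proof -
  have "0 \<le> d" "d\<^sup>2 = (mdist X1 x1 y1)\<^sup>2 + (mdist X2 x2 y2)\<^sup>2" by (simp_all add: d prod_dist_def)
  moreover have "mdist X1 x1 y1 \<le> mdist X1 x1 u1 + mdist X1 u1 y1"
    "mdist X2 x2 y2 \<le> mdist X2 x2 u2 + mdist X2 u2 y2"
    using mem by (auto intro: mdist_triangle)
  moreover have "sqrt ((mdist X1 x1 u1)\<^sup>2 + (mdist X2 x2 u2)\<^sup>2) \<le> a * d + h"
    "sqrt ((mdist X1 u1 y1)\<^sup>2 + (mdist X2 u2 y2)\<^sup>2) \<le> (1 - a) * d + h"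
    using u by (simp_all add: prod_dist_def)
  ultimately show
    "mdist X1 x1 u1 \<le> a * mdist X1 x1 y1 + s \<and> mdist X2 x2 u2 \<le> a * mdist X2 x2 y2 + s"
    "mdist X1 u1 y1 \<le> (1 - a) * mdist X1 x1 y1 + s \<and>
      mdist X2 u2 y2 \<le> (1 - a) * mdist X2 x2 y2 + s"
    using a h s coordinates_near_ratio[of a h s "mdist X1 x1 y1" "mdist X2 x2 y2" d
        "mdist X1 x1 u1" "mdist X1 u1 y1" "mdist X2 x2 u2" "mdist X2 u2 y2"]
      coordinates_near_ratio[of "1 - a" h s "mdist X1 x1 y1" "mdist X2 x2 y2" d
        "mdist X1 u1 y1" "mdist X1 x1 u1" "mdist X2 u2 y2" "mdist X2 x2 u2"]
    by (simp_all add: add.commute)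
qed

text \<open>The bound \<open>h0\<close> serves all smaller \<open>h\<close>, so bounds for several
  triangles can be replaced by their minimum.\<close>

lemma prod_metric_sides_compare:
  assumes C: "C > 0" and X: "rCAT0_star C X1" "rCAT0_star C X2"
    and xyz: "x \<in> mspace (prod_metric X1 X2)" "y \<in> mspace (prod_metric X1 X2)"
      "z \<in> mspace (prod_metric X1 X2)"
  shows "\<exists>h0>0. \<forall>h\<le>h0. \<forall>L1 \<gamma>1 L2 \<gamma>2 x' y' z'.
    short_segment (prod_metric X1 X2) h x y L1 \<gamma>1 \<longrightarrow>
    short_segment (prod_metric X1 X2) h y z L2 \<gamma>2 \<longrightarrow>
    comparison_triangle (prod_metric X1 X2) x y z x' y' z' \<longrightarrow>
    sides_compare (prod_metric X1 X2) (sqrt 2 * C) L1 \<gamma>1 x' y' L2 \<gamma>2 y' z'"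
proof -
  let ?P = "prod_metric X1 X2"
  obtain x1 x2 y1 y2 z1 z2 where eq: "x = (x1, x2)" "y = (y1, y2)" "z = (z1, z2)"
    by (metis surj_pair)
  have mem: "x1 \<in> mspace X1" "y1 \<in> mspace X1" "z1 \<in> mspace X1"
    "x2 \<in> mspace X2" "y2 \<in> mspace X2" "z2 \<in> mspace X2"
    using xyz by (auto simp: eq)
  obtain s1 where s1: "s1 > 0" and cmp1: "\<forall>u\<in>mspace X1. \<forall>v\<in>mspace X1. \<forall>a\<in>{0..1}. \<forall>b\<in>{0..1}. \<forall>x' y' z'.
    mdist X1 x1 u \<le> a * mdist X1 x1 y1 + s1 \<longrightarrow> mdist X1 u y1 \<le> (1 - a) * mdist X1 x1 y1 + s1 \<longrightarrow>
    mdist X1 y1 v \<le> b * mdist X1 y1 z1 + s1 \<longrightarrow> mdist X1 v z1 \<le> (1 - b) * mdist X1 y1 z1 + s1 \<longrightarrow>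
    comparison_triangle X1 x1 y1 z1 x' y' z' \<longrightarrow>
    mdist X1 u v \<le> dist ((1 - a) *\<^sub>R x' + a *\<^sub>R y') ((1 - b) *\<^sub>R y' + b *\<^sub>R z') + C"
    using rCAT0_star_points[OF X(1) mem(1-3)] by blast
  obtain s2 where s2: "s2 > 0" and cmp2: "\<forall>u\<in>mspace X2. \<forall>v\<in>mspace X2. \<forall>a\<in>{0..1}. \<forall>b\<in>{0..1}. \<forall>x' y' z'.
    mdist X2 x2 u \<le> a * mdist X2 x2 y2 + s2 \<longrightarrow> mdist X2 u y2 \<le> (1 - a) * mdist X2 x2 y2 + s2 \<longrightarrow>
    mdist X2 y2 v \<le> b * mdist X2 y2 z2 + s2 \<longrightarrow> mdist X2 v z2 \<le> (1 - b) * mdist X2 y2 z2 + s2 \<longrightarrow>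
    comparison_triangle X2 x2 y2 z2 x' y' z' \<longrightarrow>
    mdist X2 u v \<le> dist ((1 - a) *\<^sub>R x' + a *\<^sub>R y') ((1 - b) *\<^sub>R y' + b *\<^sub>R z') + C"
    using rCAT0_star_points[OF X(2) mem(4-6)] by blast
  obtain x1' y1' z1' where tri1: "comparison_triangle X1 x1 y1 z1 x1' y1' z1'"
    by (rule exists_comparison_triangle[OF mem(1-3)])
  obtain x2' y2' z2' where tri2: "comparison_triangle X2 x2 y2 z2 x2' y2' z2'"
    by (rule exists_comparison_triangle[OF mem(4-6)])
  define s where "s = min s1 s2"
  have s: "0 < s" "s \<le> s1" "s \<le> s2" using s1 s2 by (auto simp: s_def)
  define d where "d = max (mdist ?P x y) (mdist ?P y z)"
  have d: "0 \<le> d" "mdist ?P x y \<le> d" "mdist ?P y z \<le> d"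
    unfolding d_def by (auto intro: max.coboundedI1 simp del: mdist_prod_metric)
  \<comment> \<open>As \<open>h \<le> 1\<close>, the quantity \<open>h\<^sup>2 + 4 * d * h\<close>
    is at most \<open>h * (4 * d + 1)\<close>, hence at most \<open>s\<^sup>2\<close>. Taking
    \<open>d\<close> as the larger side length makes one \<open>h\<close> work for both
    sides.\<close>
  define h where "h = min 1 (s\<^sup>2 / (4 * d + 1))"
  have h: "0 < h" using s d by (simp add: h_def)
  have hs: "h\<^sup>2 + 4 * r * h \<le> s\<^sup>2" if "r \<le> d" for r
  proof -
    have "h * h \<le> 1 * h" using h by (intro mult_right_mono) (auto simp: h_def)
    moreover have "4 * r * h \<le> 4 * d * h" using that h by (intro mult_right_mono) auto
    moreover have "h * (4 * d + 1) \<le> s\<^sup>2"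
      using d by (simp add: h_def flip: pos_le_divide_eq)
    ultimately show ?thesis unfolding power2_eq_square by (simp add: algebra_simps)
  qed
  have "mdist ?P (\<gamma>1 r) (\<gamma>2 t) \<le> dist u' v' + sqrt 2 * C"
    if seg: "short_segment ?P h x y L1 \<gamma>1" "short_segment ?P h y z L2 \<gamma>2"
      and tri: "comparison_triangle ?P x y z x' y' z'"
      and rt: "r \<in> {0..L1}" "t \<in> {0..L2}"
      and cp: "comparison_point ?P L1 \<gamma>1 x' y' r u'" "comparison_point ?P L2 \<gamma>2 y' z' t v'"
    for L1 \<gamma>1 L2 \<gamma>2 x' y' z' r t u' v'
  proof -
    have dist': "dist x' y' = mdist ?P x y" "dist y' z' = mdist ?P y z" "dist z' x' = mdist ?P z x"
      using tri by (auto simp: comparison_triangle_def)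
    obtain a where a: "a \<in> {0..1}" "u' = (1 - a) *\<^sub>R x' + a *\<^sub>R y'"
      "mdist ?P x (\<gamma>1 r) \<le> a * mdist ?P x y + h" "mdist ?P (\<gamma>1 r) y \<le> (1 - a) * mdist ?P x y + h"
      using comparison_point_ratio[OF seg(1) rt(1) cp(1) dist'(1)] by blast
    obtain b where b: "b \<in> {0..1}" "v' = (1 - b) *\<^sub>R y' + b *\<^sub>R z'"
      "mdist ?P y (\<gamma>2 t) \<le> b * mdist ?P y z + h" "mdist ?P (\<gamma>2 t) z \<le> (1 - b) * mdist ?P y z + h"
      using comparison_point_ratio[OF seg(2) rt(2) cp(2) dist'(2)] by blast
    obtain u1 u2 v1 v2 where uv: "\<gamma>1 r = (u1, u2)" "\<gamma>2 t = (v1, v2)" by (metis surj_pair)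
    have "\<gamma>1 r \<in> mspace ?P"
      by (rule path_between_mem[OF conjunct1[OF seg(1)[unfolded short_segment_def]] rt(1)])
    moreover have "\<gamma>2 t \<in> mspace ?P"
      by (rule path_between_mem[OF conjunct1[OF seg(2)[unfolded short_segment_def]] rt(2)])
    ultimately have uv_mem: "(u1, u2) \<in> mspace ?P" "(v1, v2) \<in> mspace ?P" by (simp_all add: uv)
    \<comment> \<open>The same ratio \<open>a\<close> serves both coordinates of \<open>u\<close>,
      and likewise \<open>b\<close> for \<open>v\<close>; the comparison triangles of the factors
      are therefore divided exactly as that of the product.\<close>
    note near_u = prod_metric_near_ratio[OF xyz(1)[unfolded eq] xyz(2)[unfolded eq] uv_mem(1)
        a(1) _ _ refl a(3)[unfolded eq uv] a(4)[unfolded eq uv] hs[OF d(2)[unfolded eq]]]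
    note near_v = prod_metric_near_ratio[OF xyz(2)[unfolded eq] xyz(3)[unfolded eq] uv_mem(2)
        b(1) _ _ refl b(3)[unfolded eq uv] b(4)[unfolded eq uv] hs[OF d(3)[unfolded eq]]]
    define A1 where "A1 = dist ((1 - a) *\<^sub>R x1' + a *\<^sub>R y1') ((1 - b) *\<^sub>R y1' + b *\<^sub>R z1')"
    define A2 where "A2 = dist ((1 - a) *\<^sub>R x2' + a *\<^sub>R y2') ((1 - b) *\<^sub>R y2' + b *\<^sub>R z2')"
    have "mdist X1 u1 v1 \<le> A1 + C"
      unfolding A1_def
      by (rule cmp1[rule_format, OF _ _ a(1) b(1) _ _ _ _ tri1])
        (use near_u near_v s h uv_mem in auto)
    moreover have "mdist X2 u2 v2 \<le> A2 + C"
      unfolding A2_def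
      by (rule cmp2[rule_format, OF _ _ a(1) b(1) _ _ _ _ tri2])
        (use near_u near_v s h uv_mem in auto)
    ultimately have "sqrt ((mdist X1 u1 v1)\<^sup>2 + (mdist X2 u2 v2)\<^sup>2) \<le> sqrt ((A1 + C)\<^sup>2 + (A2 + C)\<^sup>2)"
      by (intro real_sqrt_le_mono add_mono power_mono) auto
    also have "\<dots> \<le> sqrt (A1\<^sup>2 + A2\<^sup>2) + sqrt (C\<^sup>2 + C\<^sup>2)"
      by (rule real_sqrt_sum_squares_triangle_ineq)
    also have "sqrt (C\<^sup>2 + C\<^sup>2) = sqrt 2 * C" using C by (simp add: real_sqrt_mult flip: mult_2)
    \<comment> \<open>The coefficients in \<open>dist_sq_between_sides\<close> depend only on
      \<open>a\<close> and \<open>b\<close>, and the squared side lengths of the factor triangles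
      add up to those of the product triangle.\<close>
    also have "A1\<^sup>2 + A2\<^sup>2 = (dist u' v')\<^sup>2"
      using tri1 tri2 unfolding A1_def A2_def a(2) b(2) dist_sq_between_sides dist'
      by (simp add: comparison_triangle_def eq prod_dist_def algebra_simps)
    finally show ?thesis by (simp add: uv prod_dist_def)
  qed
  then have cmp: "sides_compare ?P (sqrt 2 * C) L1 \<gamma>1 x' y' L2 \<gamma>2 y' z'"
    if "short_segment ?P h x y L1 \<gamma>1" "short_segment ?P h y z L2 \<gamma>2"
      "comparison_triangle ?P x y z x' y' z'"
    for L1 \<gamma>1 L2 \<gamma>2 x' y' z'
    unfolding sides_compare_def using that by blast
  have "sides_compare ?P (sqrt 2 * C) L1 \<gamma>1 x' y' L2 \<gamma>2 y' z'"
    if "h' \<le> h" "short_segment ?P h' x y L1 \<gamma>1" "short_segment ?P h' y z L2 \<gamma>2"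
      "comparison_triangle ?P x y z x' y' z'"
    for h' L1 \<gamma>1 L2 \<gamma>2 x' y' z'
    by (rule cmp[OF short_segment_mono[OF that(2,1)] short_segment_mono[OF that(3,1)] that(4)])
  then show ?thesis using h by blast
qed

theorem theorem5p1:
  fixes C :: real and X1 :: "'a metric" and X2 :: "'b metric"
  assumes "C > 0" and "rCAT0_star C X1" and "rCAT0_star C X2"
  shows "rCAT0_star (sqrt 2 * C) (prod_metric X1 X2)"
proof -
  let ?P = "prod_metric X1 X2"
  let ?good = "\<lambda>x y z h0. h0 > 0 \<and> (\<forall>h\<le>h0. \<forall>L1 \<gamma>1 L2 \<gamma>2 x' y' z'.
    short_segment ?P h x y L1 \<gamma>1 \<longrightarrow> short_segment ?P h y z L2 \<gamma>2 \<longrightarrow>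
    comparison_triangle ?P x y z x' y' z' \<longrightarrow>
    sides_compare ?P (sqrt 2 * C) L1 \<gamma>1 x' y' L2 \<gamma>2 y' z')"
  define F where "F x y z = (SOME h0. ?good x y z h0)" for x y z
  have F: "?good x y z (F x y z)"
    if "x \<in> mspace ?P" "y \<in> mspace ?P" "z \<in> mspace ?P" for x y z
    unfolding F_def by (rule someI_ex[OF prod_metric_sides_compare[OF assms that]])
  \<comment> \<open>\<open>F\<close> handles only the first two sides of a triangle. The other two
    pairs are the first two sides after a cyclic rotation of the vertices, so \<open>H\<close> has
    to stay below the bounds of all three rotations.\<close>
  define H where "H x y z = min (F x y z) (min (F y z x) (F z x y))" for x y z
  show ?thesis
    unfolding rCAT0_star_def
  proof (intro conjI exI[of _ H] ballI allI impI)
    show "length_space ?P"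
      using assms by (intro length_space_prod_metric) (auto simp: rCAT0_star_def)
  next
    fix x y z assume xyz: "x \<in> mspace ?P" "y \<in> mspace ?P" "z \<in> mspace ?P"
    note good = F[OF xyz] F[OF xyz(2,3,1)] F[OF xyz(3,1,2)]
    show "0 < H x y z" using good[THEN conjunct1] by (simp add: H_def)
    have le: "H x y z \<le> F x y z" "H x y z \<le> F y z x" "H x y z \<le> F z x y" by (auto simp: H_def)
    fix L1 \<gamma>1 L2 \<gamma>2 L3 \<gamma>3 x' y' z'
    assume seg: "short_segment ?P (H x y z) x y L1 \<gamma>1" "short_segment ?P (H x y z) y z L2 \<gamma>2"
      "short_segment ?P (H x y z) z x L3 \<gamma>3"
      and tri: "comparison_triangle ?P x y z x' y' z'"
    have tri': "comparison_triangle ?P y z x y' z' x'" "comparison_triangle ?P z x y z' x' y'"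
      using tri by (auto simp: comparison_triangle_def)
    show "sides_compare ?P (sqrt 2 * C) L1 \<gamma>1 x' y' L2 \<gamma>2 y' z'"
      by (rule good(1)[THEN conjunct2, rule_format, OF le(1) seg(1,2) tri])
    show "sides_compare ?P (sqrt 2 * C) L2 \<gamma>2 y' z' L3 \<gamma>3 z' x'"
      by (rule good(2)[THEN conjunct2, rule_format, OF le(2) seg(2,3) tri'(1)])
    show "sides_compare ?P (sqrt 2 * C) L3 \<gamma>3 z' x' L1 \<gamma>1 x' y'"
      by (rule good(3)[THEN conjunct2, rule_format, OF le(3) seg(3,1) tri'(2)])
  qed
qed

end
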